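(* Let $x$ range over $(0,\pi/2)$ and let $(p,q)$ satisfy $p\le 0$ or $0<p\le 3q$. (i) If $p\ge\frac75$, then $\frac{\sin x}{x}<M(\cos x;p,q)$ holds for all $x\in(0,\pi/2)$ if and only if $q\ge \frac p3+\frac8{15}$. (ii) If $p\ge p_0$, then $\frac{\sin x}{x}>M(\cos x;p,q)$ holds for all $x\in(0,\pi/2)$ if and only if $q\le q(p)$. (iii) If $p\le\frac{46}{35}$, then $\frac{\sin x}{x}>M(\cos x;p,q)$ holds for all $x\in(0,\pi/2)$ if and only if $q\le\frac p3+\frac8{15}$. (iv) If $p\le p_0^*$, then $\frac{\sin x}{x}<M(\cos x;p,q)$ holds for all $x\in(0,\pi/2)$ if and only if $q\ge q(p)$.
   Context: For $t\in(0,1)$: $M(t;p,q)=\left(1-\frac{p}{3q}+\frac{p}{3q}t^q\right)^{1/p}$ if $pq\ne0$; $M(t;0,q)=\exp\frac{t^q-1}{3q}$ if $q\neq 0$; $M(t;p,0)=\left(1+\frac p3\ln t\right)^{1/p}$ if $p\ne0$; $M(t;0,0)=t^{1/3}$. Further $q(p)=\frac{p}{3(1-(2/\pi)^p)}$ for $p\ne0$ and $q(0)=-\frac{1}{3\ln(2/\pi)}$. The number $p_0\approx1.42034$ is the unique real $p$ with $q(p)=1$, and $p_0^*\approx1.27754$ is the unique real $p$ with $q(p)=\frac{34}{35}$. *)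

theory Defs
  imports Complex_Main
begin

definition Mmean :: "real \<Rightarrow> real \<Rightarrow> real \<Rightarrow> real" where
  "Mmean t p q =
    (if p \<noteq> 0 \<and> q \<noteq> 0 then (1 - p/(3*q) + p/(3*q) * t powr q) powr (1/p)
     else if p = 0 \<and> q \<noteq> 0 then exp ((t powr q - 1) / (3*q))
     else if p \<noteq> 0 \<and> q = 0 then (1 + p/3 * ln t) powr (1/p)
     else t powr (1/3))"

definition qfun :: "real \<Rightarrow> real" where
  "qfun p = (if p \<noteq> 0 then p / (3 * (1 - (2/pi) powr p)) else - 1 / (3 * ln (2/pi)))"

definition p0 :: real where
  "p0 = (THE p. qfun p = 1)"

definition p0star :: real where
  "p0star = (THE p. qfun p = 34/35)"

end

theory Submission
  imports Defs "HOL-Analysis.Complex_Transcendental" "HOL-Real_Asymp.Real_Asymp"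
begin

text \<open>
  Put \<open>U\<^sub>p(u) = (1 - u\<^sup>p)/p\<close> (and \<open>-ln u\<close> for \<open>p = 0\<close>).
  Comparing \<open>sin x / x\<close> with the mean amounts to the sign of \<open>D(x) = 3 U\<^sub>p(sin x / x)
  - U\<^sub>q(cos x)\<close> (called \<open>gap\<close> below), which increases with \<open>q\<close>, so only
  the thresholds matter. The sign of \<open>D'\<close> is that of a function \<open>G\<close>
  (\<open>gap_slope\<close>) with \<open>G(0+) = 0\<close>, and the sign of \<open>G'\<close> is that of
  \<open>K = F + 2 - p + (q - 1) E\<close> (\<open>rate\<close>), where \<open>F\<close> and \<open>E\<close>
  do not depend on \<open>p, q\<close>. Two trigonometric inequalities show that \<open>F\<close> increases
  and \<open>F - E/35\<close> decreases; hence \<open>E\<close> increases, and \<open>K\<close> increases for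
  \<open>q \<ge> 1\<close> and decreases for \<open>q \<le> 34/35\<close>. Thus \<open>K\<close>, and with it
  \<open>G\<close> and \<open>D\<close>, changes sign at most once. At \<open>q = p/3 + 8/15\<close> the limit
  of \<open>K\<close> at \<open>0\<close> vanishes, so \<open>D\<close> is monotone; at \<open>q =
  q(p)\<close> the function \<open>D\<close> vanishes at both end points, so it has a constant sign in
  between.
\<close>

subsection \<open>Taylor polynomials as one-sided bounds\<close>

text \<open>The error of a partial sum is at most the absolute value of the first omitted term.
  Adding that term, whose sign alternates, therefore lands on the far side of
  \<open>sin y\<close>.\<close>

lemma
  fixes y :: real
  assumes "0 \<le> y"
  shows sin_taylor_even: "even n \<Longrightarrow> 0 < n \<Longrightarrow> y * (\<Sum>k<n. (-1)^k * y^(2*k) / fact (2*k+1)) \<le> sin y"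
    and sin_taylor_odd: "odd n \<Longrightarrow> sin y \<le> y * (\<Sum>k<n. (-1)^k * y^(2*k) / fact (2*k+1))"
proof -
  define T where "T n = y * (\<Sum>k<n. (-1)^k * y^(2*k) / fact (2*k+1))" for n
  have T_Suc: "T (Suc m) = T m + (-1)^m * (y^(2*m+1) / fact (2*m+1))" for m
    by (simp add: T_def algebra_simps)
  have "(\<Sum>m<2*n+1. sin_coeff m * y^m) = T n" for n
    by (induction n) (simp_all add: sin_coeff_def T_def algebra_simps)
  then have err: "\<bar>sin y - T m\<bar> \<le> y^(2*m+1) / fact (2*m+1)" for m
    using Maclaurin_sin_bound[of y "2*m+1"] assms by (simp add: field_simps)
  have "T n \<le> sin y" if n: "even n" "0 < n"
  proof -
    obtain m where "n = Suc m" using n by (cases n) auto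
    then show ?thesis
      using n err[of m] T_Suc[of m] by (simp add: abs_le_iff)
  qed
  moreover have "sin y \<le> T n" if n: "odd n"
  proof -
    obtain m where "n = Suc m" using n by (cases n) auto
    then show ?thesis
      using n err[of m] T_Suc[of m] by (simp add: abs_le_iff)
  qed
  ultimately show "even n \<Longrightarrow> 0 < n \<Longrightarrow> y * (\<Sum>k<n. (-1)^k * y^(2*k) / fact (2*k+1)) \<le> sin y"
    and "odd n \<Longrightarrow> sin y \<le> y * (\<Sum>k<n. (-1)^k * y^(2*k) / fact (2*k+1))"
    unfolding T_def by auto
qed

text \<open>The alternating argument used for the sine, with the Lagrange remainder of order
  \<open>2*m\<close>. Only even powers of \<open>y\<close> occur, so the sign of \<open>y\<close> is
  free.\<close>

lemma
  fixes y :: real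
  shows cos_taylor_even: "even n \<Longrightarrow> 0 < n \<Longrightarrow> (\<Sum>k<n. (-1)^k * y^(2*k) / fact (2*k)) \<le> cos y"
    and cos_taylor_odd: "odd n \<Longrightarrow> cos y \<le> (\<Sum>k<n. (-1)^k * y^(2*k) / fact (2*k))"
proof -
  define T where "T n = (\<Sum>k<n. (-1)^k * y^(2*k) / fact (2*k))" for n
  have T_Suc: "T (Suc m) = T m + (-1)^m * (y^(2*m) / fact (2*m))" for m
    by (simp add: T_def)
  have sum_eq: "(\<Sum>m<2*n. cos_coeff m * y^m) = T n" for n
    by (induction n) (simp_all add: cos_coeff_def T_def)
  have err: "\<bar>cos y - T m\<bar> \<le> y^(2*m) / fact (2*m)" for m
  proof -
    obtain t where "cos y = T m + cos (t + 1/2 * real (2*m) * pi) / fact (2*m) * y^(2*m)"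
      using Maclaurin_cos_expansion[of y "2*m"] unfolding sum_eq by blast
    then have "\<bar>cos y - T m\<bar> = \<bar>cos (t + 1/2 * real (2*m) * pi)\<bar> * (y^(2*m) / fact (2*m))"
      by (simp add: abs_mult)
    also have "\<dots> \<le> 1 * (y^(2*m) / fact (2*m))"
      by (intro mult_right_mono) auto
    finally show ?thesis by simp
  qed
  have "T n \<le> cos y" if n: "even n" "0 < n"
  proof -
    obtain m where "n = Suc m" using n by (cases n) auto
    then show ?thesis
      using n err[of m] T_Suc[of m] by (simp add: abs_le_iff)
  qed
  moreover have "cos y \<le> T n" if n: "odd n"
  proof -
    obtain m where "n = Suc m" using n by (cases n) auto
    then show ?thesis
      using n err[of m] T_Suc[of m] by (simp add: abs_le_iff)
  qed
  ultimately show "even n \<Longrightarrow> 0 < n \<Longrightarrow> (\<Sum>k<n. (-1)^k * y^(2*k) / fact (2*k)) \<le> cos y"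
    and "odd n \<Longrightarrow> cos y \<le> (\<Sum>k<n. (-1)^k * y^(2*k) / fact (2*k))"
    unfolding T_def by auto
qed

subsection \<open>Two trigonometric inequalities\<close>

text \<open>
  The rational coefficients below come from replacing each \<open>sin (k x)\<close> and \<open>cos (k x)\<close>
  by a Taylor polynomial that errs in the required direction, long enough that the
  lower powers of \<open>x\<close> cancel exactly.
\<close>

lemma sin_treble:
  fixes x :: real
  shows "sin (3*x) = 3 * sin x * cos x^2 - sin x^3"
proof -
  have "sin (3*x) = sin (2*x + x)" by (simp add: algebra_simps)
  then show ?thesis
    unfolding sin_add sin_double cos_double
    by (simp add: algebra_simps power2_eq_square power3_eq_cube)
qed

lemma sin_cos_five:
  fixes x :: real
  shows "sin (5*x) = 5 * cos x^4 * sin x - 10 * cos x^2 * sin x^3 + sin x^5"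
    and "cos (5*x) = cos x^5 - 10 * cos x^3 * sin x^2 + 5 * cos x * sin x^4"
proof -
  have x5: "5*x = 3*x + 2*x" by simp
  show "sin (5*x) = 5 * cos x^4 * sin x - 10 * cos x^2 * sin x^3 + sin x^5"
    unfolding x5 sin_add sin_treble cos_treble_cos sin_double cos_double
    using sin_cos_squared_add[of x] by algebra
  show "cos (5*x) = cos x^5 - 10 * cos x^3 * sin x^2 + 5 * cos x * sin x^4"
    unfolding x5 cos_add sin_treble cos_treble_cos sin_double cos_double
    using sin_cos_squared_add[of x] by algebra
qed

text \<open>The bound 5/2 is a simple rational number just above pi^2/4 = 2.467...; it delimits the
  polynomial estimates in \<open>y = x^2\<close>.\<close>

lemma sq_less_five_halves:
  fixes x :: real
  assumes "0 < x" "x < pi/2"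
  shows "x^2 < 5/2"
proof -
  have "x < 158/100" using assms pi_approx by simp
  then have "x^2 < (158/100)^2" using assms by (intro power_strict_mono) auto
  also have "\<dots> < (5/2::real)" by (simp add: power2_eq_square)
  finally show ?thesis .
qed

text \<open>This is the polynomial left over in \<open>rate_F_numerator_pos\<close>. Bounding
  \<open>y^2\<close> by \<open>5/2*y\<close> leaves a decreasing linear function that is still
  positive at 5/2.\<close>

lemma quadratic_pos:
  fixes y :: real
  assumes "0 < y" "y < 5/2"
  shows "0 < 8/4725 - 4/14175*y - 4783697/116237721600*y^2"
proof -
  have "y^2 \<le> 5/2*y" using assms by (simp add: power2_eq_square)
  then show ?thesis using assms by linarith
qed

lemma sextic_pos:
  fixes y :: real
  assumes "0 < y" "y < 5/2"
  shows "0 < 64/1575 - 416/17325*y + 46168/7882875*y^2 - 179876/212837625*y^3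
    + 3031129/36182396250*y^4 - 131040617/21173938285500*y^5 - 310319840601492721/496358721386591551488000*y^6"
proof -
  \<comment> \<open>Expanded at the right end of the interval, where the value is smallest, all but one of the coefficients are positive.\<close>
  define z where "z = 5/2 - y"
  have z: "0 < z" "z < 5/2" "y = 5/2 - z" using assms by (auto simp: z_def)
  \<comment> \<open>The one negative term, \<open>-163*z^4\<close>, is absorbed by
    \<open>5090*z^3\<close>.\<close>
  have "z^4 \<le> z^3 * (5/2)" using z by (simp add: power_Suc2 eval_nat_numeral mult_left_mono)
  moreover have "z > 0" "z^2 > 0" "z^3 > 0" "z^5 > 0" using z by auto
  \<comment> \<open>These integers are the coefficients of the claim times 10^7, rounded downwards.
    The coefficient -80 also covers the sextic term, by way of
    \<open>y^6 \<le> y^5 * (5/2)\<close>.\<close>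
  moreover have "406340 - 240120*y + 58560*y^2 - 8460*y^3 + 837*y^4 - 80*y^5
     = 1035765/16 + 138515/2*z + 27995/2*z^2 + 5090*z^3 - 163*z^4 + 80*z^5"
    unfolding z(3) by algebra
  ultimately have "0 < 406340 - 240120*y + 58560*y^2 - 8460*y^3 + 837*y^4 - 80*y^5" by linarith
  moreover have "y^6 \<le> y^5 * (5/2)" using assms by (simp add: power_Suc2 eval_nat_numeral mult_left_mono)
  moreover have "y > 0" "y^2 > 0" "y^3 > 0" "y^4 > 0" "y^5 > 0" using assms by auto
  ultimately show ?thesis by linarith
qed

text \<open>This is the numerator in the derivative of \<open>rate_F\<close>. It vanishes to order
  10 at 0, so the Taylor bounds leave \<open>x^10\<close> times a quadratic in
  \<open>x^2\<close>.\<close>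

lemma rate_F_numerator_pos:
  fixes x :: real
  assumes x0: "0 < x" and x1: "x < pi/2"
  shows "6*x * sin x - x * sin x^3 - 3 * sin x^2*cos x - 3*x^2*cos x - 2*x^3 * sin x > 0" (is "?N > 0")
proof -
  \<comment> \<open>Multiple angles replace products of sines and cosines, so that each term has one
    trigonometric factor and can be bounded separately.\<close>
  have N: "?N = 21/4*(x * sin x) + 1/4*(x * sin (3*x)) + 3/4*cos (3*x) - 3/4*cos x - 3*(x^2*cos x) - 2*(x^3 * sin x)"
    unfolding cos_treble_cos sin_treble using sin_cos_squared_add[of x] by algebra
  have b0: "x * (x * (1 - x^2/6 + x^4/120 - x^6/5040 + x^8/362880 - x^10/39916800)) \<le> x * sin x"
    using sin_taylor_even[where y="x" and n=6] x0
    by (intro mult_left_mono) (simp_all add: lessThan_nat_numeral fact_numeral power2_eq_square algebra_simps)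
  have b1: "x * ((3*x) * (1 - (3*x)^2/6 + (3*x)^4/120 - (3*x)^6/5040 + (3*x)^8/362880
      - (3*x)^10/39916800)) \<le> x * sin (3*x)"
    using sin_taylor_even[where y="3*x" and n=6] x0
    by (intro mult_left_mono) (simp_all add: lessThan_nat_numeral fact_numeral power2_eq_square algebra_simps)
  have b2: "(1 - (3*x)^2/2 + (3*x)^4/24 - (3*x)^6/720 + (3*x)^8/40320 - (3*x)^10/3628800 + (3*x)^12/479001600
      - (3*x)^14/87178291200) \<le> cos (3*x)"
    using cos_taylor_even[where y="3*x" and n=8] x0
    by (simp add: lessThan_nat_numeral fact_numeral power2_eq_square algebra_simps)
  have b3: "cos x \<le> (1 - x^2/2 + x^4/24 - x^6/720 + x^8/40320 - x^10/3628800 + x^12/479001600)"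
    using cos_taylor_odd[where y="x" and n=7] x0
    by (simp add: lessThan_nat_numeral fact_numeral power2_eq_square algebra_simps)
  have b4: "x^2 * cos x \<le> x^2 * (1 - x^2/2 + x^4/24 - x^6/720 + x^8/40320 - x^10/3628800 + x^12/479001600)"
    using cos_taylor_odd[where y="x" and n=7] x0
    by (intro mult_left_mono) (simp_all add: lessThan_nat_numeral fact_numeral power2_eq_square algebra_simps)
  have b5: "x^3 * sin x \<le> x^3 * (x * (1 - x^2/6 + x^4/120 - x^6/5040 + x^8/362880))"
    using sin_taylor_odd[where y="x" and n=5] x0
    by (intro mult_left_mono) (simp_all add: lessThan_nat_numeral fact_numeral power2_eq_square algebra_simps)
  \<comment> \<open>The difference is a combination of the six Taylor errors with positive
    coefficients.\<close>
  have "?N - x^10 * (8/4725 - 4/14175*x^2 - 4783697/116237721600*(x^2)^2) =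
    21/4 * (x * sin x - x * (x * (1 - x^2/6 + x^4/120 - x^6/5040 + x^8/362880 - x^10/39916800)))
    + 1/4 * (x * sin (3*x) - x * ((3*x) * (1 - (3*x)^2/6 + (3*x)^4/120 - (3*x)^6/5040 + (3*x)^8/362880
      - (3*x)^10/39916800)))
    + 3/4 * (cos (3*x) - (1 - (3*x)^2/2 + (3*x)^4/24 - (3*x)^6/720 + (3*x)^8/40320 - (3*x)^10/3628800
      + (3*x)^12/479001600 - (3*x)^14/87178291200))
    + 3/4 * ((1 - x^2/2 + x^4/24 - x^6/720 + x^8/40320 - x^10/3628800 + x^12/479001600) - cos x)
    + 3 * (x^2 * (1 - x^2/2 + x^4/24 - x^6/720 + x^8/40320 - x^10/3628800 + x^12/479001600) - x^2 * cos x)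
    + 2 * (x^3 * (x * (1 - x^2/6 + x^4/120 - x^6/5040 + x^8/362880)) - x^3 * sin x)"
    unfolding N by algebra
  also have "\<dots> \<ge> 0"
    using b0 b1 b2 b3 b4 b5 by (intro add_nonneg_nonneg mult_nonneg_nonneg) simp_all
  finally have "x^10 * (8/4725 - 4/14175*x^2 - 4783697/116237721600*(x^2)^2) \<le> ?N" by simp
  moreover have "0 < x^10 * (8/4725 - 4/14175*x^2 - 4783697/116237721600*(x^2)^2)"
    using quadratic_pos[of "x^2"] sq_less_five_halves[OF assms] x0 by simp
  ultimately show ?thesis by linarith
qed

text \<open>Up to a positive factor this is the derivative of
  \<open>rate_E x / 35 - rate_F x\<close>. The \<open>x^10\<close> terms of the two parts cancel, so
  the expansion starts at \<open>x^12\<close>.\<close>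

lemma rate_diff_numerator_pos:
  fixes x :: real
  assumes x0: "0 < x" and x1: "x < pi/2"
  shows "sin x^4*cos x + x * sin x^5 - 3*x^2 * sin x^2*cos x + 72*x^3 * sin x*cos x^2 - 210*x * sin x*cos x^2
    + 35*x * sin x^3*cos x^2 + 105 * sin x^2*cos x^3 + 105*x^2*cos x^3 > 0" (is "?N > 0")
proof -
  have N: "?N = 53/4*cos x - 27/4*cos (3*x) - 13/2*cos (5*x)
      - 95/2*(x * sin x) - 405/8*(x * sin (3*x)) - 17/8*(x * sin (5*x))
      + 78*(x^2*cos x) + 27*(x^2*cos (3*x)) + 18*(x^3 * sin x) + 18*(x^3 * sin (3*x))"
    unfolding cos_treble_cos sin_treble sin_cos_five using sin_cos_squared_add[of x] by algebra
  \<comment> \<open>The polynomials are long because \<open>5*x\<close> reaches almost 5*pi/2, where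
    short ones are useless.\<close>
  have b0: "cos (5*x) \<le> (1 - (5*x)^2/2 + (5*x)^4/24 - (5*x)^6/720 + (5*x)^8/40320 - (5*x)^10/3628800
      + (5*x)^12/479001600 - (5*x)^14/87178291200 + (5*x)^16/20922789888000 - (5*x)^18/6402373705728000
      + (5*x)^20/2432902008176640000 - (5*x)^22/1124000727777607680000 + (5*x)^24/620448401733239439360000)"
    using cos_taylor_odd[where y="5*x" and n=13] x0
    by (simp add: lessThan_nat_numeral fact_numeral power2_eq_square algebra_simps)
  have b1: "cos (3*x) \<le> (1 - (3*x)^2/2 + (3*x)^4/24 - (3*x)^6/720 + (3*x)^8/40320 - (3*x)^10/3628800
      + (3*x)^12/479001600 - (3*x)^14/87178291200 + (3*x)^16/20922789888000 - (3*x)^18/6402373705728000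
      + (3*x)^20/2432902008176640000 - (3*x)^22/1124000727777607680000 + (3*x)^24/620448401733239439360000)"
    using cos_taylor_odd[where y="3*x" and n=13] x0
    by (simp add: lessThan_nat_numeral fact_numeral power2_eq_square algebra_simps)
  have b2: "(1 - x^2/2 + x^4/24 - x^6/720 + x^8/40320 - x^10/3628800 + x^12/479001600 - x^14/87178291200
      + x^16/20922789888000 - x^18/6402373705728000 + x^20/2432902008176640000
      - x^22/1124000727777607680000) \<le> cos x"
    using cos_taylor_even[where y="x" and n=12] x0
    by (simp add: lessThan_nat_numeral fact_numeral power2_eq_square algebra_simps)
  have b3: "x * sin (5*x) \<le> x * ((5*x) * (1 - (5*x)^2/6 + (5*x)^4/120 - (5*x)^6/5040 + (5*x)^8/362880
      - (5*x)^10/39916800 + (5*x)^12/6227020800 - (5*x)^14/1307674368000 + (5*x)^16/355687428096000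
      - (5*x)^18/121645100408832000 + (5*x)^20/51090942171709440000))"
    using sin_taylor_odd[where y="5*x" and n=11] x0
    by (intro mult_left_mono) (simp_all add: lessThan_nat_numeral fact_numeral power2_eq_square algebra_simps)
  have b4: "x * sin (3*x) \<le> x * ((3*x) * (1 - (3*x)^2/6 + (3*x)^4/120 - (3*x)^6/5040 + (3*x)^8/362880
      - (3*x)^10/39916800 + (3*x)^12/6227020800 - (3*x)^14/1307674368000 + (3*x)^16/355687428096000
      - (3*x)^18/121645100408832000 + (3*x)^20/51090942171709440000))"
    using sin_taylor_odd[where y="3*x" and n=11] x0
    by (intro mult_left_mono) (simp_all add: lessThan_nat_numeral fact_numeral power2_eq_square algebra_simps)
  have b5: "x * sin x \<le> x * (x * (1 - x^2/6 + x^4/120 - x^6/5040 + x^8/362880 - x^10/39916800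
      + x^12/6227020800 - x^14/1307674368000 + x^16/355687428096000 - x^18/121645100408832000
      + x^20/51090942171709440000))"
    using sin_taylor_odd[where y="x" and n=11] x0
    by (intro mult_left_mono) (simp_all add: lessThan_nat_numeral fact_numeral power2_eq_square algebra_simps)
  have b6: "x^2 * (1 - (3*x)^2/2 + (3*x)^4/24 - (3*x)^6/720 + (3*x)^8/40320 - (3*x)^10/3628800
      + (3*x)^12/479001600 - (3*x)^14/87178291200 + (3*x)^16/20922789888000 - (3*x)^18/6402373705728000
      + (3*x)^20/2432902008176640000 - (3*x)^22/1124000727777607680000) \<le> x^2 * cos (3*x)"
    using cos_taylor_even[where y="3*x" and n=12] x0
    by (intro mult_left_mono) (simp_all add: lessThan_nat_numeral fact_numeral power2_eq_square algebra_simps)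
  have b7: "x^2 * (1 - x^2/2 + x^4/24 - x^6/720 + x^8/40320 - x^10/3628800 + x^12/479001600 - x^14/87178291200
      + x^16/20922789888000 - x^18/6402373705728000 + x^20/2432902008176640000
      - x^22/1124000727777607680000) \<le> x^2 * cos x"
    using cos_taylor_even[where y="x" and n=12] x0
    by (intro mult_left_mono) (simp_all add: lessThan_nat_numeral fact_numeral power2_eq_square algebra_simps)
  have b8: "x^3 * ((3*x) * (1 - (3*x)^2/6 + (3*x)^4/120 - (3*x)^6/5040 + (3*x)^8/362880 - (3*x)^10/39916800
      + (3*x)^12/6227020800 - (3*x)^14/1307674368000 + (3*x)^16/355687428096000
      - (3*x)^18/121645100408832000)) \<le> x^3 * sin (3*x)"
    using sin_taylor_even[where y="3*x" and n=10] x0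
    by (intro mult_left_mono) (simp_all add: lessThan_nat_numeral fact_numeral power2_eq_square algebra_simps)
  have b9: "x^3 * (x * (1 - x^2/6 + x^4/120 - x^6/5040 + x^8/362880 - x^10/39916800 + x^12/6227020800
      - x^14/1307674368000 + x^16/355687428096000 - x^18/121645100408832000)) \<le> x^3 * sin x"
    using sin_taylor_even[where y="x" and n=10] x0
    by (intro mult_left_mono) (simp_all add: lessThan_nat_numeral fact_numeral power2_eq_square algebra_simps)
  have "?N - x^12 * (64/1575 - 416/17325*x^2 + 46168/7882875*(x^2)^2 - 179876/212837625*(x^2)^3
     + 3031129/36182396250*(x^2)^4 - 131040617/21173938285500*(x^2)^5
     - 310319840601492721/496358721386591551488000*(x^2)^6) =
    13/2 * ((1 - (5*x)^2/2 + (5*x)^4/24 - (5*x)^6/720 + (5*x)^8/40320 - (5*x)^10/3628800 + (5*x)^12/479001600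
      - (5*x)^14/87178291200 + (5*x)^16/20922789888000 - (5*x)^18/6402373705728000
      + (5*x)^20/2432902008176640000 - (5*x)^22/1124000727777607680000 + (5*x)^24/620448401733239439360000)
      - cos (5*x))
    + 27/4 * ((1 - (3*x)^2/2 + (3*x)^4/24 - (3*x)^6/720 + (3*x)^8/40320 - (3*x)^10/3628800 + (3*x)^12/479001600
      - (3*x)^14/87178291200 + (3*x)^16/20922789888000 - (3*x)^18/6402373705728000
      + (3*x)^20/2432902008176640000 - (3*x)^22/1124000727777607680000 + (3*x)^24/620448401733239439360000)
      - cos (3*x))
    + 53/4 * (cos x - (1 - x^2/2 + x^4/24 - x^6/720 + x^8/40320 - x^10/3628800 + x^12/479001600
      - x^14/87178291200 + x^16/20922789888000 - x^18/6402373705728000 + x^20/2432902008176640000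
      - x^22/1124000727777607680000))
    + 17/8 * (x * ((5*x) * (1 - (5*x)^2/6 + (5*x)^4/120 - (5*x)^6/5040 + (5*x)^8/362880 - (5*x)^10/39916800
      + (5*x)^12/6227020800 - (5*x)^14/1307674368000 + (5*x)^16/355687428096000 - (5*x)^18/121645100408832000
      + (5*x)^20/51090942171709440000)) - x * sin (5*x))
    + 405/8 * (x * ((3*x) * (1 - (3*x)^2/6 + (3*x)^4/120 - (3*x)^6/5040 + (3*x)^8/362880 - (3*x)^10/39916800
      + (3*x)^12/6227020800 - (3*x)^14/1307674368000 + (3*x)^16/355687428096000 - (3*x)^18/121645100408832000
      + (3*x)^20/51090942171709440000)) - x * sin (3*x))
    + 95/2 * (x * (x * (1 - x^2/6 + x^4/120 - x^6/5040 + x^8/362880 - x^10/39916800 + x^12/6227020800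
      - x^14/1307674368000 + x^16/355687428096000 - x^18/121645100408832000 + x^20/51090942171709440000))
      - x * sin x)
    + 27 * (x^2 * cos (3*x) - x^2 * (1 - (3*x)^2/2 + (3*x)^4/24 - (3*x)^6/720 + (3*x)^8/40320 - (3*x)^10/3628800
      + (3*x)^12/479001600 - (3*x)^14/87178291200 + (3*x)^16/20922789888000 - (3*x)^18/6402373705728000
      + (3*x)^20/2432902008176640000 - (3*x)^22/1124000727777607680000))
    + 78 * (x^2 * cos x - x^2 * (1 - x^2/2 + x^4/24 - x^6/720 + x^8/40320 - x^10/3628800 + x^12/479001600
      - x^14/87178291200 + x^16/20922789888000 - x^18/6402373705728000 + x^20/2432902008176640000
      - x^22/1124000727777607680000))
    + 18 * (x^3 * sin (3*x) - x^3 * ((3*x) * (1 - (3*x)^2/6 + (3*x)^4/120 - (3*x)^6/5040 + (3*x)^8/362880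
      - (3*x)^10/39916800 + (3*x)^12/6227020800 - (3*x)^14/1307674368000 + (3*x)^16/355687428096000
      - (3*x)^18/121645100408832000)))
    + 18 * (x^3 * sin x - x^3 * (x * (1 - x^2/6 + x^4/120 - x^6/5040 + x^8/362880 - x^10/39916800
      + x^12/6227020800 - x^14/1307674368000 + x^16/355687428096000 - x^18/121645100408832000)))"
    unfolding N by algebra
  also have "\<dots> \<ge> 0"
    using b0 b1 b2 b3 b4 b5 b6 b7 b8 b9 by (intro add_nonneg_nonneg mult_nonneg_nonneg) simp_all
  finally have "x^12 * (64/1575 - 416/17325*x^2 + 46168/7882875*(x^2)^2 - 179876/212837625*(x^2)^3
     + 3031129/36182396250*(x^2)^4 - 131040617/21173938285500*(x^2)^5
     - 310319840601492721/496358721386591551488000*(x^2)^6) \<le> ?N" by simp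
  moreover have "0 < x^12 * (64/1575 - 416/17325*x^2 + 46168/7882875*(x^2)^2 - 179876/212837625*(x^2)^3
     + 3031129/36182396250*(x^2)^4 - 131040617/21173938285500*(x^2)^5
     - 310319840601492721/496358721386591551488000*(x^2)^6)"
    using sextic_pos[of "x^2"] sq_less_five_halves[OF assms] x0 by simp
  ultimately show ?thesis by linarith
qed

subsection \<open>Signs from derivatives and boundary limits\<close>

text \<open>A limit replaces the value at \<open>a\<close> because \<open>gap\<close> and
  \<open>gap_slope\<close> contain quotients that have no meaningful value at 0.\<close>

lemma pos_if_deriv_pos_tendsto_0:
  fixes f f' :: "real \<Rightarrow> real"
  assumes deriv: "\<And>x. a < x \<Longrightarrow> x < b \<Longrightarrow> (f has_real_derivative f' x) (at x)"
    and pos: "\<And>x. a < x \<Longrightarrow> x < b \<Longrightarrow> 0 < f' x"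
    and lim: "(f \<longlongrightarrow> 0) (at_right a)"
    and x: "a < x" "x < b"
  shows "0 < f x"
proof -
  have incr: "f u < f v" if "a < u" "u < v" "v < b" for u v
  proof (rule DERIV_pos_imp_increasing[of u v f])
    fix w assume "u \<le> w" "w \<le> v"
    then show "\<exists>y. (f has_real_derivative y) (at w) \<and> 0 < y"
      using that deriv[of w] pos[of w] by auto
  qed (use that in auto)
  \<comment> \<open>The limit gives only the weak inequality at \<open>m\<close>; strictness comes
    from the increase between \<open>m\<close> and \<open>x\<close>.\<close>
  define m where "m = (a + x)/2"
  have m: "a < m" "m < x" using x by (auto simp: m_def)
  have "eventually (\<lambda>u. u \<in> {a<..<m}) (at_right a)"
    using m by (intro eventually_at_right_real)
  then have "eventually (\<lambda>u. f u \<le> f m) (at_right a)"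
    by (rule eventually_mono) (use incr m x in \<open>auto intro!: less_imp_le\<close>)
  then have "0 \<le> f m"
    using lim by (intro tendsto_upperbound[OF lim]) auto
  also have "f m < f x" using incr m x by auto
  finally show ?thesis .
qed

text \<open>At most one sign change, from negative to positive, with constant sign included. This
  form passes from a derivative to an antiderivative that tends to 0 at the left end.\<close>

definition upcrossing :: "real \<Rightarrow> real \<Rightarrow> (real \<Rightarrow> real) \<Rightarrow> bool" where
  "upcrossing a b f \<longleftrightarrow> (\<forall>x y. a < x \<longrightarrow> x < y \<longrightarrow> y < b \<longrightarrow> 0 \<le> f x \<longrightarrow> 0 < f y)"

text \<open>If \<open>g x\<close> were negative, \<open>g\<close> would be negative on all of
  \<open>(a, x]\<close>, and \<open>f\<close> would decrease from its limit 0 to a negative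
  \<open>f x\<close>. Only the sign of \<open>f'\<close> matters, so \<open>g\<close> may drop
  positive factors.\<close>

lemma upcrossing_antideriv:
  fixes f f' g :: "real \<Rightarrow> real"
  assumes deriv: "\<And>x. a < x \<Longrightarrow> x < b \<Longrightarrow> (f has_real_derivative f' x) (at x)"
    and sgn: "\<And>x. a < x \<Longrightarrow> x < b \<Longrightarrow> sgn (f' x) = sgn (g x)"
    and g: "upcrossing a b g"
    and lim: "(f \<longlongrightarrow> 0) (at_right a)"
    and x: "a < x" "x < b" and fx: "0 \<le> f x"
  shows "0 \<le> g x" and "\<And>u v. x \<le> u \<Longrightarrow> u < v \<Longrightarrow> v < b \<Longrightarrow> f u < f v"
proof -
  show gx: "0 \<le> g x"
  proof (rule ccontr)
    assume "\<not> 0 \<le> g x"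
    have neg: "f' u < 0" if u: "a < u" "u \<le> x" for u
    proof -
      have "u < x \<longrightarrow> 0 \<le> g u \<longrightarrow> 0 < g x"
        using g x u unfolding upcrossing_def by auto
      then have "g u < 0"
        using \<open>\<not> 0 \<le> g x\<close> u by (cases "u = x") auto
      then show ?thesis
        using sgn[of u] u x by (simp add: sgn_1_neg)
    qed
    have decr: "f v < f u" if "a < u" "u < v" "v \<le> x" for u v
    proof (rule DERIV_neg_imp_decreasing[of u v f])
      fix w assume "u \<le> w" "w \<le> v"
      then show "\<exists>y. (f has_real_derivative y) (at w) \<and> y < 0"
        using that x deriv[of w] neg[of w] by auto
    qed (use that in auto)
    have "0 < - f ((a+x)/2)"
      by (rule pos_if_deriv_pos_tendsto_0[of a x "\<lambda>x. - f x" "\<lambda>x. - f' x"])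
        (use x neg deriv tendsto_minus[OF lim] in \<open>auto intro!: derivative_eq_intros\<close>)
    moreover have "f x < f ((a+x)/2)" using decr x by auto
    ultimately show False using fx by linarith
  qed
  fix u v assume uv: "x \<le> u" "u < v" "v < b"
  have pos: "0 < f' w" if "u < w" "w < v" for w
  proof -
    have "0 < g w"
      using g gx that uv x unfolding upcrossing_def by auto
    then show ?thesis
      using sgn[of w] that uv x by (simp add: sgn_1_pos)
  qed
  moreover have "continuous_on {u..v} f"
    using deriv uv x by (intro DERIV_continuous_on[of _ f f']) (auto intro: has_field_derivative_at_within)
  ultimately show "f u < f v"
  proof (intro DERIV_pos_imp_increasing_open[of u v f])
    fix w assume "u < w" "w < v"
    then show "\<exists>y. (f has_real_derivative y) (at w) \<and> 0 < y"
      using uv x deriv[of w] pos[of w] by auto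
  qed (use uv in auto)
qed

lemma upcrossing_if_sgn_deriv:
  fixes f f' g :: "real \<Rightarrow> real"
  assumes "\<And>x. a < x \<Longrightarrow> x < b \<Longrightarrow> (f has_real_derivative f' x) (at x)"
    and "\<And>x. a < x \<Longrightarrow> x < b \<Longrightarrow> sgn (f' x) = sgn (g x)"
    and "upcrossing a b g"
    and "(f \<longlongrightarrow> 0) (at_right a)"
  shows "upcrossing a b f"
  unfolding upcrossing_def
proof (intro allI impI)
  fix x y assume xy: "a < x" "x < y" "y < b" "0 \<le> f x"
  then have "f x < f y"
    using upcrossing_antideriv(2)[OF assms, of x x y] by auto
  then show "0 < f y" using xy by simp
qed

text \<open>Once nonnegative, \<open>f\<close> increases strictly up to \<open>b\<close>, so it
  cannot return to the limit 0 there.\<close>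

lemma neg_if_sgn_deriv_upcrossing:
  fixes f f' g :: "real \<Rightarrow> real"
  assumes deriv: "\<And>x. a < x \<Longrightarrow> x < b \<Longrightarrow> (f has_real_derivative f' x) (at x)"
    and sgn: "\<And>x. a < x \<Longrightarrow> x < b \<Longrightarrow> sgn (f' x) = sgn (g x)"
    and g: "upcrossing a b g"
    and lim: "(f \<longlongrightarrow> 0) (at_right a)" "(f \<longlongrightarrow> 0) (at_left b)"
    and x: "a < x" "x < b"
  shows "f x < 0"
proof (rule ccontr)
  assume "\<not> f x < 0"
  then have fx: "0 \<le> f x" by simp
  note incr = upcrossing_antideriv(2)[OF deriv sgn g lim(1) x fx]
  define m where "m = (x + b)/2"
  have m: "x < m" "m < b" using x by (auto simp: m_def)
  have "eventually (\<lambda>u. u \<in> {m<..<b}) (at_left b)"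
    using m by (intro eventually_at_left_real)
  then have "eventually (\<lambda>u. f m \<le> f u) (at_left b)"
    by (rule eventually_mono) (use incr m in \<open>auto intro!: less_imp_le\<close>)
  then have "f m \<le> 0"
    by (intro tendsto_lowerbound[OF lim(2)]) auto
  moreover have "f x < f m" using incr[of x m] m by auto
  ultimately show False using fx by linarith
qed

subsection \<open>The deformed logarithm\<close>

text \<open>
  Solving for the mean in \<open>u = Mmean t p q\<close> turns all four cases of its definition into
  \<open>3 * neg_qlog p u = neg_qlog q t\<close>.
\<close>

definition neg_qlog :: "real \<Rightarrow> real \<Rightarrow> real" where
  "neg_qlog p u = (if p = 0 then - ln u else (1 - u powr p) / p)"

lemma neg_qlog_deriv:
  assumes "0 < u"
  shows "(neg_qlog p has_real_derivative - (u powr (p - 1))) (at u)"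
proof (cases "p = 0")
  case True
  have "((\<lambda>u. - ln u) has_real_derivative - (u powr (p - 1))) (at u)"
    using assms True by (auto intro!: derivative_eq_intros simp: powr_minus divide_inverse)
  then show ?thesis using True by (simp add: neg_qlog_def[abs_def])
next
  case False
  have "((\<lambda>u. (1 - u powr p) / p) has_real_derivative - (u powr (p - 1))) (at u)"
    using assms False by (auto intro!: derivative_eq_intros simp: powr_diff)
  then show ?thesis using False by (simp add: neg_qlog_def[abs_def])
qed

lemma neg_qlog_1 [simp]: "neg_qlog p 1 = 0"
  by (simp add: neg_qlog_def)

lemma tendsto_neg_qlog:
  assumes "(f \<longlongrightarrow> l) F" "0 < l"
  shows "((\<lambda>x. neg_qlog p (f x)) \<longlongrightarrow> neg_qlog p l) F"
  using assms by (intro isCont_tendsto_compose[OF DERIV_isCont[OF neg_qlog_deriv]])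

lemma neg_qlog_strict_antimono:
  assumes "0 < u" "u < v"
  shows "neg_qlog p v < neg_qlog p u"
proof (rule DERIV_neg_imp_decreasing[of u v "neg_qlog p"])
  fix w assume "u \<le> w" "w \<le> v"
  then show "\<exists>y. (neg_qlog p has_real_derivative y) (at w) \<and> y < 0"
    using assms neg_qlog_deriv[of w p] by (intro exI[of _ "- (w powr (p - 1))"]) auto
qed (use assms in auto)

lemma neg_qlog_less_iff:
  assumes "0 < u" "0 < v"
  shows "neg_qlog p v < neg_qlog p u \<longleftrightarrow> u < v"
  using neg_qlog_strict_antimono[of u v p] neg_qlog_strict_antimono[of v u p] assms
  by (metis less_asym linorder_neqE_linordered_idom less_irrefl)

lemma neg_qlog_pos: "0 < u \<Longrightarrow> u < 1 \<Longrightarrow> 0 < neg_qlog p u"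
  using neg_qlog_strict_antimono[of u 1 p] by simp

text \<open>The difference \<open>neg_qlog p t - neg_qlog q t\<close> vanishes at 1 and has negative
  derivative on (0,1). Monotonicity of \<open>qfun\<close> and of \<open>gap\<close> in
  \<open>q\<close> both rest on this.\<close>

lemma neg_qlog_strict_antimono_exponent:
  assumes "0 < t" "t < 1" "p < q"
  shows "neg_qlog q t < neg_qlog p t"
proof -
  have "neg_qlog p 1 - neg_qlog q 1 < neg_qlog p t - neg_qlog q t"
  proof (rule DERIV_neg_imp_decreasing_open[of t 1 "\<lambda>t. neg_qlog p t - neg_qlog q t"])
    fix x assume x: "t < x" "x < 1"
    have "x powr (q - 1) < x powr (p - 1)"
      using x assms by (intro powr_less_mono') auto
    then show "\<exists>y. ((\<lambda>t. neg_qlog p t - neg_qlog q t) has_real_derivative y) (at x) \<and> y < 0"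
      using x assms by (intro exI[of _ "- (x powr (p-1)) - - (x powr (q-1))"] conjI DERIV_diff neg_qlog_deriv) auto
  next
    show "continuous_on {t..1} (\<lambda>t. neg_qlog p t - neg_qlog q t)"
      using assms
      by (intro continuous_at_imp_continuous_on ballI continuous_diff DERIV_isCont[OF neg_qlog_deriv]) auto
  qed (use assms in auto)
  then show ?thesis by simp
qed

lemma neg_qlog_antimono_exponent:
  assumes "0 < t" "t < 1" "p \<le> q"
  shows "neg_qlog q t \<le> neg_qlog p t"
  using neg_qlog_strict_antimono_exponent[of t p q] assms by (cases "p = q") auto

lemma tendsto_neg_qlog_0:
  assumes "(f \<longlongrightarrow> 0) F" "eventually (\<lambda>x. 0 < f x) F" "0 < q"
  shows "((\<lambda>x. neg_qlog q (f x)) \<longlongrightarrow> 1/q) F"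
proof -
  have "eventually (\<lambda>x. 0 \<le> f x) F"
    using assms(2) by (rule eventually_mono) simp
  then have "((\<lambda>x. f x powr q) \<longlongrightarrow> 0 powr q) F"
    using assms by (intro tendsto_powr') auto
  then have "((\<lambda>x. (1 - f x powr q) / q) \<longlongrightarrow> (1 - 0) / q) F"
    using assms(3) by (intro tendsto_intros) auto
  then show ?thesis using assms(3) by (simp add: neg_qlog_def)
qed

lemma Mmean_iff:
  assumes adm: "p \<le> 0 \<or> (0 < p \<and> p \<le> 3*q)" and t: "0 < t" "t < 1" and u: "0 < u"
  shows "u < Mmean t p q \<longleftrightarrow> neg_qlog q t < 3 * neg_qlog p u"
    and "Mmean t p q < u \<longleftrightarrow> 3 * neg_qlog p u < neg_qlog q t"
proof -
  have "0 < Mmean t p q \<and> 3 * neg_qlog p (Mmean t p q) = neg_qlog q t"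
  proof (cases "p = 0")
    case True
    then show ?thesis
      using t by (auto simp: Mmean_def neg_qlog_def ln_powr field_simps)
  next
    case False
    have M: "Mmean t p q = (1 - p/3 * neg_qlog q t) powr (1/p)"
      using False t by (auto simp: Mmean_def neg_qlog_def field_simps)
    \<comment> \<open>Admissibility of \<open>(p, q)\<close> makes the base of the outer power
      positive, so the power can be inverted. For positive \<open>p\<close> the point is that
      \<open>neg_qlog q t\<close> stays below \<open>1/q\<close>.\<close>
    have "0 < 1 - p/3 * neg_qlog q t"
    proof (cases "p \<le> 0")
      case True
      then have "p/3 * neg_qlog q t \<le> 0"
        using neg_qlog_pos[of t q] t by (intro mult_nonpos_nonneg) auto
      then show ?thesis by linarith
    next
      case False
      then have q: "0 < q" "p \<le> 3*q" using adm by auto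
      have "neg_qlog q t < 1/q" using q t by (simp add: neg_qlog_def divide_strict_right_mono)
      then have "p/3 * neg_qlog q t < p/3 * (1/q)" using False by (intro mult_strict_left_mono) auto
      also have "\<dots> \<le> 1" using q by (simp add: field_simps)
      finally show ?thesis by linarith
    qed
    then have "Mmean t p q powr p = 1 - p/3 * neg_qlog q t" "0 < Mmean t p q"
      using False unfolding M by (simp_all add: powr_powr)
    then show ?thesis
      using False unfolding neg_qlog_def[of p] by (simp add: field_simps)
  qed
  then have M: "0 < Mmean t p q" "neg_qlog q t = 3 * neg_qlog p (Mmean t p q)" by auto
  show "u < Mmean t p q \<longleftrightarrow> neg_qlog q t < 3 * neg_qlog p u"
    using neg_qlog_less_iff[OF u M(1), of p] unfolding M(2) by simp
  show "Mmean t p q < u \<longleftrightarrow> 3 * neg_qlog p u < neg_qlog q t"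
    using neg_qlog_less_iff[OF M(1) u, of p] unfolding M(2) by simp
qed

subsection \<open>The threshold at the right end point\<close>

lemma two_over_pi: "0 < 2/pi" "2/pi < 1"
  using pi_gt3 by (auto simp: field_simps)

text \<open>As 2/pi is the value of \<open>sin x / x\<close> at pi/2, this exhibits
  \<open>qfun p\<close> as the \<open>q\<close> for which \<open>gap\<close> tends to 0
  there.\<close>

lemma qfun_eq: "qfun p = 1 / (3 * neg_qlog p (2/pi))"
  by (simp add: qfun_def neg_qlog_def)

lemma qfun_pos: "0 < qfun p"
  unfolding qfun_eq using neg_qlog_pos[OF two_over_pi, of p] by simp

lemma qfun_strict_mono: "strict_mono qfun"
proof (rule strict_monoI)
  fix p p' :: real assume "p < p'"
  then show "qfun p < qfun p'"
    using neg_qlog_strict_antimono_exponent[OF two_over_pi, of p p'] neg_qlog_pos[OF two_over_pi, of p']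
    unfolding qfun_eq by (intro divide_strict_left_mono) auto
qed

text \<open>Existence comes from the intermediate value theorem, as \<open>qfun 1\<close> is about
  0.917 and \<open>qfun 2\<close> about 1.121; uniqueness comes from strict monotonicity. The cases
  \<open>r = 1\<close> and \<open>r = 34/35\<close> give \<open>p0\<close> and \<open>p0star\<close>
  their defining property.\<close>

lemma qfun_THE:
  assumes "34/35 \<le> r" "r \<le> 1"
  shows "qfun (THE p. qfun p = r) = r"
proof -
  define a where "a = 2/pi"
  have a: "63/100 \<le> a" "a \<le> 64/100"
    using pi_approx by (auto simp: a_def field_simps)
  have "qfun 1 = 1 / (3 * (1 - a))" using a by (simp add: qfun_def a_def)
  also have "\<dots> \<le> 34/35" using a by (simp add: field_simps)
  finally have "qfun 1 \<le> r" using assms by simp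
  have a2: "(63/100)^2 \<le> a^2" "a^2 \<le> (64/100)^2"
    using a by (intro power_mono; simp)+
  have "r \<le> 1" by fact
  also have "1 \<le> 2 / (3 * (1 - a^2))"
    using a2 by (simp add: field_simps)
  also have "\<dots> = qfun 2" using a by (simp add: qfun_def a_def)
  finally have "r \<le> qfun 2" .
  moreover have "continuous_on {1..2} qfun"
  proof -
    have "continuous_on {1..2} (\<lambda>p. p / (3 * (1 - (2/pi) powr p)))"
      using two_over_pi by (intro continuous_intros) (auto simp: powr_less_one)
    then show ?thesis by (rule continuous_on_eq) (auto simp: qfun_def)
  qed
  ultimately obtain p where "qfun p = r"
    using IVT'[of qfun 1 r 2] \<open>qfun 1 \<le> r\<close> by auto
  then have "\<exists>!p. qfun p = r"
    using strict_mono_eq[OF qfun_strict_mono] by metis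
  then show ?thesis by (rule theI')
qed

lemma qfun_ge_1: "p0 \<le> p \<Longrightarrow> 1 \<le> qfun p"
  using qfun_THE[of 1, folded p0_def] strict_mono_less_eq[OF qfun_strict_mono, of p0 p] by simp

lemma qfun_le: "p \<le> p0star \<Longrightarrow> qfun p \<le> 34/35"
  using qfun_THE[of "34/35", folded p0star_def] strict_mono_less_eq[OF qfun_strict_mono, of p p0star]
  by simp

subsection \<open>The difference function and its derivative\<close>

text \<open>The derivative of \<open>sin x / x\<close> is \<open>- sin_gap x / x^2\<close>.\<close>

definition sin_gap :: "real \<Rightarrow> real" where
  "sin_gap x = sin x - x * cos x"

definition gap :: "real \<Rightarrow> real \<Rightarrow> real \<Rightarrow> real" where
  "gap p q x = 3 * neg_qlog p (sin x / x) - neg_qlog q (cos x)"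

text \<open>\<open>gap_slope\<close> is the logarithm of the quotient of the two terms of the derivative of \<open>gap\<close>.\<close>

definition gap_slope :: "real \<Rightarrow> real \<Rightarrow> real \<Rightarrow> real" where
  "gap_slope p q x = ln (3 * sin_gap x / x^3) + (p - 2) * ln (sin x / x) - (q - 1) * ln (cos x)"

text \<open>Dividing the derivative of \<open>gap_slope\<close> by
  \<open>sin_gap x / (x * sin x)\<close> turns its middle term into the constant
  \<open>2 - p\<close>; \<open>rate_F\<close> and \<open>rate_E\<close> are what the other two terms
  become.\<close>

definition rate_F :: "real \<Rightarrow> real" where
  "rate_F x = sin x * (x^2 * sin x - 3 * sin_gap x) / (sin_gap x)^2"

definition rate_E :: "real \<Rightarrow> real" where
  "rate_E x = x * (sin x)^2 / (cos x * sin_gap x)"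

definition rate :: "real \<Rightarrow> real \<Rightarrow> real \<Rightarrow> real" where
  "rate p q x = rate_F x + 2 - p + (q - 1) * rate_E x"

section \<open>Monotonicity of \<open>rate\<close> and its limit at 0\<close>

lemma sin_cos_pos:
  assumes "0 < x" "x < pi/2"
  shows "0 < sin x" "0 < cos x" "cos x < 1"
proof -
  show "0 < sin x" using assms by (intro sin_gt_zero) auto
  show "0 < cos x" using assms by (intro cos_gt_zero)
  show "cos x < 1" using cos_monotone_0_pi[of 0 x] assms by simp
qed

lemma sin_gap_deriv: "(sin_gap has_real_derivative x * sin x) (at x)"
  unfolding sin_gap_def[abs_def] by (auto intro!: derivative_eq_intros)

lemma sin_gap_pos:
  assumes "0 < x" "x < pi/2"
  shows "0 < sin_gap x"
proof (rule pos_if_deriv_pos_tendsto_0[of 0 "pi/2" sin_gap "\<lambda>x. x * sin x"])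
  show "(sin_gap \<longlongrightarrow> 0) (at_right 0)"
    unfolding sin_gap_def[abs_def] by real_asymp
  show "0 < x * sin x" if "0 < x" "x < pi/2" for x :: real
    using sin_cos_pos[OF that] that by simp
qed (use assms sin_gap_deriv in auto)

lemma rate_F_deriv:
  assumes x: "0 < x" "x < pi/2"
  shows "(rate_F has_real_derivative
    (6*x * sin x - x * sin x^3 - 3 * sin x^2 * cos x - 3*x^2*cos x - 2*x^3 * sin x) / sin_gap x^3) (at x)"
proof -
  note sin_gap_pos[OF x]
  define a where "a = cos x * (x^2 * sin x - 3 * sin_gap x) + sin x * (2*x * sin x + x^2 * cos x - 3 * (x * sin x))"
  define b where "b = sin x * (x^2 * sin x - 3 * sin_gap x)"
  have 1: "((\<lambda>x. sin x * (x^2 * sin x - 3 * sin_gap x)) has_real_derivative a) (at x)"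
    unfolding a_def by (auto intro!: derivative_eq_intros sin_gap_deriv simp: algebra_simps)
  have 2: "((\<lambda>x. sin_gap x^2) has_real_derivative 2 * sin_gap x * (x * sin x)) (at x)"
    by (auto intro!: derivative_eq_intros sin_gap_deriv simp: algebra_simps)
  have "(rate_F has_real_derivative (a * sin_gap x^2 - b * (2 * sin_gap x * (x * sin x))) / (sin_gap x^2 * sin_gap x^2)) (at x)"
    using DERIV_divide[OF 1 2] \<open>0 < sin_gap x\<close> unfolding rate_F_def[abs_def] b_def by simp
  moreover have "(a * sin_gap x^2 - b * (2 * sin_gap x * (x * sin x))) / (sin_gap x^2 * sin_gap x^2)
      = (a * sin_gap x - b * (2 * (x * sin x))) / sin_gap x^3"
    using \<open>0 < sin_gap x\<close> by (simp add: field_simps power2_eq_square power3_eq_cube)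
  moreover have "a * sin_gap x - b * (2 * (x * sin x))
      = 6*x * sin x - x * sin x^3 - 3 * sin x^2 * cos x - 3*x^2*cos x - 2*x^3 * sin x"
    unfolding a_def b_def sin_gap_def using sin_cos_squared_add[of x] by algebra
  ultimately show ?thesis by simp
qed

lemma rate_E_deriv:
  assumes x: "0 < x" "x < pi/2"
  shows "(rate_E has_real_derivative
    sin x * (sin x^2 * cos x + x * sin x - 2*x^2*cos x) / (cos x^2 * sin_gap x^2)) (at x)"
proof -
  note sin_gap_pos[OF x] sin_cos_pos[OF x]
  have 1: "((\<lambda>x. x * sin x^2) has_real_derivative sin x^2 + x * (2 * sin x * cos x)) (at x)"
    by (auto intro!: derivative_eq_intros simp: algebra_simps)
  have 2: "((\<lambda>x. cos x * sin_gap x) has_real_derivative cos x * (x * sin x) - sin x * sin_gap x) (at x)"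
    by (auto intro!: derivative_eq_intros sin_gap_deriv simp: algebra_simps)
  have "(sin x^2 + x * (2 * sin x * cos x)) * (cos x * sin_gap x) - x * sin x^2 * (cos x * (x * sin x) - sin x * sin_gap x)
      = sin x * (sin x^2 * cos x + x * sin x - 2*x^2*cos x)"
    unfolding sin_gap_def using sin_cos_squared_add[of x] by algebra
  moreover have "cos x * sin_gap x * (cos x * sin_gap x) = cos x^2 * sin_gap x^2"
    by (simp add: power2_eq_square)
  ultimately show ?thesis
    using DERIV_divide[OF 1 2] \<open>0 < sin_gap x\<close> \<open>0 < cos x\<close> unfolding rate_E_def[abs_def] by simp
qed

lemma rate_F_strict_mono:
  assumes "0 < x" "x < y" "y < pi/2"
  shows "rate_F x < rate_F y"
proof (rule DERIV_pos_imp_increasing[of x y rate_F])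
  fix w assume "x \<le> w" "w \<le> y"
  then have w: "0 < w" "w < pi/2" using assms by auto
  show "\<exists>d. (rate_F has_real_derivative d) (at w) \<and> 0 < d"
    by (rule exI, rule conjI[OF rate_F_deriv[OF w]]) (intro divide_pos_pos rate_F_numerator_pos[OF w] zero_less_power sin_gap_pos[OF w])
qed (use assms in auto)

text \<open>The factor 1/35 is the limit at 0 of the quotient of the derivatives of
  \<open>rate_F\<close> and \<open>rate_E\<close>, which behave like \<open>8/175*x\<close> and
  \<open>8/5*x\<close>.\<close>

lemma rate_diff_strict_antimono:
  assumes "0 < x" "x < y" "y < pi/2"
  shows "rate_F y - rate_E y / 35 < rate_F x - rate_E x / 35"
proof (rule DERIV_neg_imp_decreasing[of x y "\<lambda>x. rate_F x - rate_E x / 35"])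
  fix w assume "x \<le> w" "w \<le> y"
  then have w: "0 < w" "w < pi/2" using assms by auto
  note sin_gap_pos[OF w] sin_cos_pos[OF w]
  define n where "n = sin w^4*cos w + w * sin w^5 - 3*w^2 * sin w^2*cos w + 72*w^3 * sin w*cos w^2
    - 210*w * sin w*cos w^2 + 35*w * sin w^3*cos w^2 + 105 * sin w^2*cos w^3 + 105*w^2*cos w^3"
  define m where "m = 6*w * sin w - w * sin w^3 - 3 * sin w^2 * cos w - 3*w^2*cos w - 2*w^3 * sin w"
  define k where "k = sin w * (sin w^2 * cos w + w * sin w - 2*w^2*cos w)"
  have "((\<lambda>x. rate_F x - rate_E x / 35) has_real_derivative m / sin_gap w^3 - k / (cos w^2 * sin_gap w^2) / 35) (at w)"
    unfolding m_def k_def by (intro DERIV_diff DERIV_cdivide rate_F_deriv rate_E_deriv w)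
  moreover have n: "n = sin_gap w * k - 35 * cos w^2 * m"
    unfolding n_def m_def k_def sin_gap_def using sin_cos_squared_add[of w] by algebra
  have "m / sin_gap w^3 - k / (cos w^2 * sin_gap w^2) / 35 = - (n / (35 * cos w^2 * sin_gap w^3))"
    unfolding n using \<open>0 < sin_gap w\<close> \<open>0 < cos w\<close> by (simp add: field_simps power2_eq_square power3_eq_cube)
  moreover have "0 < n" unfolding n_def by (rule rate_diff_numerator_pos[OF w])
  then have "0 < n / (35 * cos w^2 * sin_gap w^3)"
    using \<open>0 < sin_gap w\<close> \<open>0 < cos w\<close> by auto
  ultimately show "\<exists>d. ((\<lambda>x. rate_F x - rate_E x / 35) has_real_derivative d) (at w) \<and> d < 0"
    by (metis neg_less_0_iff_less)
qed (use assms in auto)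

lemma rate_E_strict_mono:
  assumes "0 < x" "x < y" "y < pi/2"
  shows "rate_E x < rate_E y"
  using rate_F_strict_mono[OF assms] rate_diff_strict_antimono[OF assms] by simp

lemma rate_strict_mono:
  assumes "1 \<le> q" "0 < x" "x < y" "y < pi/2"
  shows "rate p q x < rate p q y"
proof -
  have "(q - 1) * rate_E x \<le> (q - 1) * rate_E y"
    using assms rate_E_strict_mono[of x y] by (intro mult_left_mono) auto
  then show ?thesis
    using rate_F_strict_mono[of x y] assms by (simp add: rate_def)
qed

lemma rate_strict_antimono:
  assumes "q \<le> 34/35" "0 < x" "x < y" "y < pi/2"
  shows "rate p q y < rate p q x"
proof -
  have "(34/35 - q) * rate_E x \<le> (34/35 - q) * rate_E y"
    using assms rate_E_strict_mono[of x y] by (intro mult_left_mono) auto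
  \<comment> \<open>With 34/35 = 1 - 1/35, \<open>rate\<close> splits into the decreasing
    difference, a nonpositive multiple of \<open>rate_E\<close>, and a constant.\<close>
  moreover have "rate p q z = (rate_F z - rate_E z / 35) - (34/35 - q) * rate_E z + 2 - p" for z
    by (simp add: rate_def field_simps)
  ultimately show ?thesis
    using rate_diff_strict_antimono[of x y] assms by simp
qed

text \<open>\<open>rate_F\<close> tends to -3/5 and \<open>rate_E\<close> to 3; this is the origin
  of the threshold \<open>p/3 + 8/15\<close>.\<close>

lemma rate_tendsto_0: "((\<lambda>x. rate p q x) \<longlongrightarrow> 3 * (q - (p/3 + 8/15))) (at_right 0)"
proof -
  have "(rate_F \<longlongrightarrow> -3/5) (at_right 0)"
    unfolding rate_F_def[abs_def] sin_gap_def by (real_asymp, simp add: power2_eq_square)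
  moreover have "(rate_E \<longlongrightarrow> 3) (at_right 0)"
    unfolding rate_E_def[abs_def] sin_gap_def by real_asymp
  ultimately have "((\<lambda>x. rate_F x + 2 - p + (q - 1) * rate_E x) \<longlongrightarrow> -3/5 + 2 - p + (q - 1) * 3) (at_right 0)"
    by (intro tendsto_intros)
  then show ?thesis by (simp add: rate_def algebra_simps)
qed

section \<open>Derivatives and boundary limits of the difference function\<close>

lemma gap_slope_deriv:
  assumes x: "0 < x" "x < pi/2"
  shows "(gap_slope p q has_real_derivative sin_gap x / (x * sin x) * rate p q x) (at x)"
proof -
  note sin_gap_pos[OF x] sin_cos_pos[OF x]
  have "((\<lambda>x. ln (3 * sin_gap x / x^3)) has_real_derivative x * sin x / sin_gap x - 3 / x) (at x)"
    using \<open>0 < sin_gap x\<close> x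
    by (auto intro!: derivative_eq_intros sin_gap_deriv simp: field_simps eval_nat_numeral)
  moreover have "((\<lambda>x. ln (sin x / x)) has_real_derivative - (sin_gap x / (x * sin x))) (at x)"
    using \<open>0 < sin x\<close> x
    by (auto intro!: derivative_eq_intros simp: field_simps sin_gap_def)
  moreover have "((\<lambda>x. ln (cos x)) has_real_derivative - (sin x / cos x)) (at x)"
    using \<open>0 < cos x\<close> by (auto intro!: derivative_eq_intros)
  ultimately have "(gap_slope p q has_real_derivative
      (x * sin x / sin_gap x - 3 / x) + (p - 2) * - (sin_gap x / (x * sin x)) - (q - 1) * - (sin x / cos x)) (at x)"
    unfolding gap_slope_def[abs_def] by (intro DERIV_diff DERIV_add DERIV_cmult)
  moreover have "(x * sin x / sin_gap x - 3 / x) + (p - 2) * - (sin_gap x / (x * sin x)) - (q - 1) * - (sin x / cos x)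
      = sin_gap x / (x * sin x) * rate p q x"
    using \<open>0 < sin_gap x\<close> \<open>0 < sin x\<close> \<open>0 < cos x\<close> x
    unfolding rate_def rate_F_def rate_E_def by (simp add: divide_simps) algebra
  ultimately show ?thesis by simp
qed

lemma gap_slope_tendsto_0: "(gap_slope p q \<longlongrightarrow> 0) (at_right 0)"
  unfolding gap_slope_def[abs_def] sin_gap_def by real_asymp

lemma gap_deriv:
  assumes x: "0 < x" "x < pi/2"
  shows "(gap p q has_real_derivative cos x powr (q - 1) * sin x * (exp (gap_slope p q x) - 1)) (at x)"
proof -
  note sin_gap_pos[OF x] sin_cos_pos[OF x]
  define u where "u = sin x / x"
  have u: "0 < u" using x \<open>0 < sin x\<close> by (simp add: u_def)
  have "((\<lambda>x. sin x / x) has_real_derivative - (sin_gap x / x^2)) (at x)"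
    using x by (auto intro!: derivative_eq_intros simp: field_simps sin_gap_def power2_eq_square)
  from DERIV_chain2[OF neg_qlog_deriv[OF u[unfolded u_def]] this]
  have 1: "((\<lambda>x. neg_qlog p (sin x / x)) has_real_derivative u powr (p - 1) * (sin_gap x / x^2)) (at x)"
    by (simp add: u_def)
  have 2: "((\<lambda>x. neg_qlog q (cos x)) has_real_derivative cos x powr (q - 1) * sin x) (at x)"
    using DERIV_chain2[OF neg_qlog_deriv[OF \<open>0 < cos x\<close>] DERIV_cos] by simp
  have "(gap p q has_real_derivative 3 * (u powr (p - 1) * (sin_gap x / x^2)) - cos x powr (q - 1) * sin x) (at x)"
    unfolding gap_def[abs_def] by (intro DERIV_diff DERIV_cmult 1 2)
  moreover have "exp (gap_slope p q x) = 3 * sin_gap x / x^3 * u powr (p - 2) / cos x powr (q - 1)"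
    using \<open>0 < sin_gap x\<close> \<open>0 < cos x\<close> u x
    by (simp add: gap_slope_def exp_add exp_diff powr_def u_def[symmetric])
  then have "cos x powr (q - 1) * sin x * (exp (gap_slope p q x) - 1)
      = 3 * (u powr (p - 2) * u * (sin_gap x / x^2)) - cos x powr (q - 1) * sin x"
    using \<open>0 < cos x\<close> x by (simp add: u_def field_simps power2_eq_square power3_eq_cube)
  moreover have "u powr (p - 1) = u powr (p - 2) * u"
    using u powr_add[of u "p - 2" 1] by simp
  ultimately show ?thesis by simp
qed

lemma sgn_gap_deriv:
  assumes x: "0 < x" "x < pi/2"
  shows "sgn (cos x powr (q - 1) * sin x * (exp (gap_slope p q x) - 1)) = sgn (gap_slope p q x)"
proof -
  have "sgn (exp (gap_slope p q x) - 1) = sgn (gap_slope p q x)" by (simp add: sgn_if)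
  then show ?thesis using sin_cos_pos[OF x] by (simp add: sgn_mult)
qed

lemma sgn_gap_slope_deriv:
  assumes x: "0 < x" "x < pi/2"
  shows "sgn (sin_gap x / (x * sin x) * rate p q x) = sgn (rate p q x)"
proof -
  have "0 < sin_gap x / (x * sin x)" using sin_cos_pos[OF x] sin_gap_pos[OF x] x by simp
  then show ?thesis by (simp only: sgn_mult sgn_pos mult_1_left)
qed

lemma gap_tendsto_0: "(gap p q \<longlongrightarrow> 0) (at_right 0)"
proof -
  have "((\<lambda>x::real. sin x / x) \<longlongrightarrow> 1) (at_right 0)" "((\<lambda>x::real. cos x) \<longlongrightarrow> 1) (at_right 0)"
    by real_asymp+
  then have "((\<lambda>x. 3 * neg_qlog p (sin x / x) - neg_qlog q (cos x)) \<longlongrightarrow> 3 * neg_qlog p 1 - neg_qlog q 1) (at_right 0)"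
    by (intro tendsto_intros tendsto_neg_qlog) auto
  then show ?thesis by (simp add: gap_def[abs_def])
qed

text \<open>Positivity of \<open>q\<close> keeps \<open>neg_qlog q (cos x)\<close> bounded as the
  cosine tends to 0; for \<open>q \<le> 0\<close> it diverges.\<close>

lemma gap_tendsto_pi_half:
  assumes "0 < q"
  shows "(gap p q \<longlongrightarrow> 1 / qfun p - 1 / q) (at_left (pi/2))"
proof -
  have "((\<lambda>x. sin x / x) \<longlongrightarrow> sin (pi/2) / (pi/2)) (at_left (pi/2))"
    by (intro tendsto_intros) auto
  then have "((\<lambda>x. neg_qlog p (sin x / x)) \<longlongrightarrow> neg_qlog p (2/pi)) (at_left (pi/2))"
    by (intro tendsto_neg_qlog) auto
  moreover have "((\<lambda>x. neg_qlog q (cos x)) \<longlongrightarrow> 1/q) (at_left (pi/2))"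
  proof (rule tendsto_neg_qlog_0)
    have "(cos \<longlongrightarrow> cos (pi/2)) (at_left (pi/2))"
      by (intro tendsto_intros)
    then show "(cos \<longlongrightarrow> 0) (at_left (pi/2))" by simp
    have "eventually (\<lambda>x. x \<in> {0<..<pi/2}) (at_left (pi/2))"
      by (intro eventually_at_left_real) simp
    then show "eventually (\<lambda>x. 0 < cos x) (at_left (pi/2))"
      by (rule eventually_mono) (use sin_cos_pos in auto)
  qed fact
  ultimately have "((\<lambda>x. 3 * neg_qlog p (sin x / x) - neg_qlog q (cos x)) \<longlongrightarrow> 3 * neg_qlog p (2/pi) - 1/q) (at_left (pi/2))"
    by (intro tendsto_intros)
  then show ?thesis by (simp add: gap_def[abs_def] qfun_eq)
qed

text \<open>The free right end \<open>b\<close> allows use both on the whole interval and on a small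
  interval at 0.\<close>

lemma gap_pos:
  assumes b: "b \<le> pi/2" and rate: "\<And>x. 0 < x \<Longrightarrow> x < b \<Longrightarrow> 0 < rate p q x" and x: "0 < x" "x < b"
  shows "0 < gap p q x"
proof -
  have gap_slope: "0 < gap_slope p q y" if y: "0 < y" "y < b" for y
  proof (rule pos_if_deriv_pos_tendsto_0[OF gap_slope_deriv _ gap_slope_tendsto_0 y])
    fix z assume "0 < z" "z < b"
    then show "0 < sin_gap z / (z * sin z) * rate p q z"
      using b rate[of z] sin_cos_pos[of z] sin_gap_pos[of z] by simp
  qed (use b in auto)
  show ?thesis
  proof (rule pos_if_deriv_pos_tendsto_0[OF gap_deriv _ gap_tendsto_0 x])
    fix z assume "0 < z" "z < b"
    then show "0 < cos z powr (q - 1) * sin z * (exp (gap_slope p q z) - 1)"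
      using b gap_slope[of z] sin_cos_pos[of z] by simp
  qed (use b in auto)
qed

lemma gap_neg:
  assumes b: "b \<le> pi/2" and rate: "\<And>x. 0 < x \<Longrightarrow> x < b \<Longrightarrow> rate p q x < 0" and x: "0 < x" "x < b"
  shows "gap p q x < 0"
proof -
  have gap_slope: "0 < - gap_slope p q y" if y: "0 < y" "y < b" for y
  proof (rule pos_if_deriv_pos_tendsto_0[OF DERIV_minus[OF gap_slope_deriv[of _ p q]] _ _ y])
    fix z assume "0 < z" "z < b"
    then show "0 < - (sin_gap z / (z * sin z) * rate p q z)"
      using b rate[of z] sin_cos_pos[of z] sin_gap_pos[of z] by (simp add: mult_pos_neg divide_neg_pos)
  next
    show "((\<lambda>x. - gap_slope p q x) \<longlongrightarrow> 0) (at_right 0)"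
      using tendsto_minus[OF gap_slope_tendsto_0] by simp
  qed (use b in auto)
  have "0 < - gap p q x"
  proof (rule pos_if_deriv_pos_tendsto_0[OF DERIV_minus[OF gap_deriv[of _ p q]] _ _ x])
    fix z assume "0 < z" "z < b"
    then show "0 < - (cos z powr (q - 1) * sin z * (exp (gap_slope p q z) - 1))"
      using b gap_slope[of z] sin_cos_pos[of z] unfolding neg_0_less_iff_less by (intro mult_pos_neg mult_pos_pos) auto
  next
    show "((\<lambda>x. - gap p q x) \<longlongrightarrow> 0) (at_right 0)"
      using tendsto_minus[OF gap_tendsto_0] by simp
  qed (use b in auto)
  then show ?thesis by simp
qed

text \<open>At \<open>p = 7/5\<close> the threshold \<open>p/3 + 8/15\<close> equals 1, so from
  there on \<open>rate\<close> increases strictly, starting from the limit 0.\<close>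

lemma gap_pos_threshold_0:
  assumes "p \<ge> 7/5" and x: "0 < x" "x < pi/2"
  shows "0 < gap p (p/3 + 8/15) x"
proof (rule gap_pos[OF order_refl _ x])
  fix y :: real assume y: "0 < y" "y < pi/2"
  define q where "q = p/3 + 8/15"
  have mono: "rate p q u < rate p q v" if "0 < u" "u < v" "v < pi/2" for u v
    using assms that by (intro rate_strict_mono) (auto simp: q_def)
  have "eventually (\<lambda>u. u \<in> {0<..<y/2}) (at_right 0)"
    using y by (intro eventually_at_right_real) auto
  then have "eventually (\<lambda>u. rate p q u \<le> rate p q (y/2)) (at_right 0)"
    by (rule eventually_mono) (use mono y in \<open>auto intro!: less_imp_le\<close>)
  then have "0 \<le> rate p q (y/2)"
    using rate_tendsto_0[of p q] by (intro tendsto_upperbound[of "rate p q"]) (auto simp: q_def)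
  then show "0 < rate p (p/3 + 8/15) y"
    using mono[of "y/2" y] y by (simp add: q_def)
qed

text \<open>At \<open>p = 46/35\<close> the threshold equals 34/35, so up to there
  \<open>rate\<close> decreases strictly from the limit 0.\<close>

lemma gap_neg_threshold_0:
  assumes "p \<le> 46/35" and x: "0 < x" "x < pi/2"
  shows "gap p (p/3 + 8/15) x < 0"
proof (rule gap_neg[OF order_refl _ x])
  fix y :: real assume y: "0 < y" "y < pi/2"
  define q where "q = p/3 + 8/15"
  have mono: "rate p q v < rate p q u" if "0 < u" "u < v" "v < pi/2" for u v
    using assms that by (intro rate_strict_antimono) (auto simp: q_def)
  have "eventually (\<lambda>u. u \<in> {0<..<y/2}) (at_right 0)"
    using y by (intro eventually_at_right_real) auto
  then have "eventually (\<lambda>u. rate p q (y/2) \<le> rate p q u) (at_right 0)"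
    by (rule eventually_mono) (use mono y in \<open>auto intro!: less_imp_le\<close>)
  then have "rate p q (y/2) \<le> 0"
    using rate_tendsto_0[of p q] by (intro tendsto_lowerbound[of "rate p q"]) (auto simp: q_def)
  then show "rate p (p/3 + 8/15) y < 0"
    using mono[of "y/2" y] y by (simp add: q_def)
qed

text \<open>The increasing \<open>rate\<close> is an upcrossing, hence so is
  \<open>gap_slope\<close>; since \<open>gap\<close> tends to 0 at both ends, it is negative in
  between.\<close>

lemma gap_neg_threshold_pi_half:
  assumes "1 \<le> qfun p" and x: "0 < x" "x < pi/2"
  shows "gap p (qfun p) x < 0"
proof -
  let ?q = "qfun p"
  have "upcrossing 0 (pi/2) (rate p ?q)"
    unfolding upcrossing_def using rate_strict_mono[OF assms(1)] by (auto intro: le_less_trans)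
  then have "upcrossing 0 (pi/2) (gap_slope p ?q)"
    by (intro upcrossing_if_sgn_deriv[OF gap_slope_deriv sgn_gap_slope_deriv _ gap_slope_tendsto_0]) auto
  then show ?thesis
    using gap_tendsto_pi_half[OF qfun_pos[of p], of p]
    by (intro neg_if_sgn_deriv_upcrossing[OF gap_deriv sgn_gap_deriv _ gap_tendsto_0 _ x]) auto
qed

lemma gap_pos_threshold_pi_half:
  assumes "qfun p \<le> 34/35" and x: "0 < x" "x < pi/2"
  shows "0 < gap p (qfun p) x"
proof -
  let ?q = "qfun p"
  have "upcrossing 0 (pi/2) (\<lambda>x. - rate p ?q x)"
    unfolding upcrossing_def using rate_strict_antimono[OF assms(1)] by (auto intro: less_le_trans)
  then have up: "upcrossing 0 (pi/2) (\<lambda>x. - gap_slope p ?q x)"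
    using tendsto_minus[OF gap_slope_tendsto_0[of p ?q]]
    by (intro upcrossing_if_sgn_deriv[OF DERIV_minus[OF gap_slope_deriv[of _ p ?q]]]) (simp_all only: sgn_minus sgn_gap_slope_deriv minus_zero)
  have "- gap p ?q x < 0"
    using tendsto_minus[OF gap_tendsto_0[of p ?q]] tendsto_minus[OF gap_tendsto_pi_half[OF qfun_pos[of p], of p]]
    by (intro neg_if_sgn_deriv_upcrossing[OF DERIV_minus[OF gap_deriv[of _ p ?q]] _ up _ _ x])
      (simp_all only: sgn_minus sgn_gap_deriv minus_zero diff_self)
  then show ?thesis by simp
qed

section \<open>Necessity of the thresholds\<close>

lemma gap_pos_imp_ge_threshold_0:
  assumes "\<And>x. 0 < x \<Longrightarrow> x < pi/2 \<Longrightarrow> 0 < gap p q x"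
  shows "p/3 + 8/15 \<le> q"
proof (rule ccontr)
  assume "\<not> p/3 + 8/15 \<le> q"
  \<comment> \<open>Below the threshold \<open>rate\<close> has a negative limit at 0, which forces
    \<open>gap\<close> to be negative near 0.\<close>
  then have "eventually (\<lambda>x. rate p q x < 0) (at_right 0)"
    using rate_tendsto_0[of p q] by (intro order_tendstoD(2)) auto
  then obtain b where b: "0 < b" "\<And>x. 0 < x \<Longrightarrow> x < b \<Longrightarrow> rate p q x < 0"
    unfolding eventually_at_right_field by auto
  define c where "c = min b (pi/2)"
  have c: "0 < c" "c \<le> b" "c \<le> pi/2" using b by (auto simp: c_def)
  have "gap p q (c/2) < 0"
    by (rule gap_neg[OF c(3)]) (use b c in auto)
  then show False using assms[of "c/2"] c by auto
qed

lemma gap_neg_imp_le_threshold_0: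
  assumes "\<And>x. 0 < x \<Longrightarrow> x < pi/2 \<Longrightarrow> gap p q x < 0"
  shows "q \<le> p/3 + 8/15"
proof (rule ccontr)
  assume "\<not> q \<le> p/3 + 8/15"
  then have "eventually (\<lambda>x. 0 < rate p q x) (at_right 0)"
    using rate_tendsto_0[of p q] by (intro order_tendstoD(1)) auto
  then obtain b where b: "0 < b" "\<And>x. 0 < x \<Longrightarrow> x < b \<Longrightarrow> 0 < rate p q x"
    unfolding eventually_at_right_field by auto
  define c where "c = min b (pi/2)"
  have c: "0 < c" "c \<le> b" "c \<le> pi/2" using b by (auto simp: c_def)
  have "0 < gap p q (c/2)"
    by (rule gap_pos[OF c(3)]) (use b c in auto)
  then show False using assms[of "c/2"] c by auto
qed

lemma gap_mono:
  assumes "q \<le> q'" and x: "0 < x" "x < pi/2"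
  shows "gap p q x \<le> gap p q' x"
  using neg_qlog_antimono_exponent[of "cos x" q q'] assms(1) sin_cos_pos[OF x] by (simp add: gap_def)

lemma eventually_at_left_pi_half:
  assumes "\<And>x. 0 < x \<Longrightarrow> x < pi/2 \<Longrightarrow> Q x"
  shows "eventually Q (at_left (pi/2))"
proof -
  have "eventually (\<lambda>x. x \<in> {0<..<pi/2}) (at_left (pi/2))"
    by (intro eventually_at_left_real) simp
  then show ?thesis by (rule eventually_mono) (use assms in auto)
qed

lemma gap_neg_imp_le_qfun:
  assumes gap: "\<And>x. 0 < x \<Longrightarrow> x < pi/2 \<Longrightarrow> gap p q x < 0"
  shows "q \<le> qfun p"
proof (cases "0 < q")
  case True
  have "1 / qfun p - 1 / q \<le> 0"
    by (rule tendsto_upperbound[OF gap_tendsto_pi_half[OF True]])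
      (auto intro!: eventually_at_left_pi_half less_imp_le gap)
  then show ?thesis using True qfun_pos[of p] by (simp add: field_simps)
next
  case False
  then show ?thesis using qfun_pos[of p] by simp
qed

lemma gap_pos_imp_ge_qfun:
  assumes gap: "\<And>x. 0 < x \<Longrightarrow> x < pi/2 \<Longrightarrow> 0 < gap p q x"
  shows "qfun p \<le> q"
proof (rule ccontr)
  assume "\<not> qfun p \<le> q"
  \<comment> \<open>The limit at pi/2 needs a positive exponent, which \<open>q\<close> may fail to
    be. So \<open>q\<close> is raised to a positive \<open>r\<close> still below
    \<open>qfun p\<close>, and \<open>gap\<close> stays nonnegative.\<close>
  define r where "r = (max q 0 + qfun p) / 2"
  have r: "q \<le> r" "0 < r" "r < qfun p"
    using \<open>\<not> qfun p \<le> q\<close> qfun_pos[of p] by (auto simp: r_def max_def)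
  have "0 \<le> gap p r x" if "0 < x" "x < pi/2" for x
    using gap[OF that] gap_mono[OF r(1) that, of p] by simp
  then have "0 \<le> 1 / qfun p - 1 / r"
    by (intro tendsto_lowerbound[OF gap_tendsto_pi_half[OF r(2)]]) (auto intro!: eventually_at_left_pi_half)
  then show False using r by (simp add: field_simps)
qed

theorem theorem3:
  fixes p q :: real
  assumes "p \<le> 0 \<or> (0 < p \<and> p \<le> 3*q)"
  shows "(p \<ge> 7/5 \<longrightarrow>
           ((\<forall>x\<in>{0<..<pi/2}. sin x / x < Mmean (cos x) p q) \<longleftrightarrow> q \<ge> p/3 + 8/15))
       \<and> (p \<ge> p0 \<longrightarrow>
           ((\<forall>x\<in>{0<..<pi/2}. sin x / x > Mmean (cos x) p q) \<longleftrightarrow> q \<le> qfun p))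
       \<and> (p \<le> 46/35 \<longrightarrow>
           ((\<forall>x\<in>{0<..<pi/2}. sin x / x > Mmean (cos x) p q) \<longleftrightarrow> q \<le> p/3 + 8/15))
       \<and> (p \<le> p0star \<longrightarrow>
           ((\<forall>x\<in>{0<..<pi/2}. sin x / x < Mmean (cos x) p q) \<longleftrightarrow> q \<ge> qfun p))"
proof -
  have lt: "sin x / x < Mmean (cos x) p q \<longleftrightarrow> 0 < gap p q x"
    and gt: "Mmean (cos x) p q < sin x / x \<longleftrightarrow> gap p q x < 0" if "x \<in> {0<..<pi/2}" for x
    using Mmean_iff[OF assms, of "cos x" "sin x / x"] sin_cos_pos[of x] that by (auto simp: gap_def)
  have "(\<forall>x\<in>{0<..<pi/2}. sin x / x < Mmean (cos x) p q) \<longleftrightarrow> (\<forall>x. 0 < x \<longrightarrow> x < pi/2 \<longrightarrow> 0 < gap p q x)"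
    and "(\<forall>x\<in>{0<..<pi/2}. sin x / x > Mmean (cos x) p q) \<longleftrightarrow> (\<forall>x. 0 < x \<longrightarrow> x < pi/2 \<longrightarrow> gap p q x < 0)"
    using lt gt by auto
  note iffs = this
  show ?thesis
    unfolding iffs
  proof (intro conjI impI iffI allI)
    show "p/3 + 8/15 \<le> q" if "\<forall>x. 0 < x \<longrightarrow> x < pi/2 \<longrightarrow> 0 < gap p q x"
      using gap_pos_imp_ge_threshold_0[of p q] that by blast
    show "q \<le> qfun p" if "\<forall>x. 0 < x \<longrightarrow> x < pi/2 \<longrightarrow> gap p q x < 0"
      using gap_neg_imp_le_qfun[of p q] that by blast
    show "q \<le> p/3 + 8/15" if "\<forall>x. 0 < x \<longrightarrow> x < pi/2 \<longrightarrow> gap p q x < 0"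
      using gap_neg_imp_le_threshold_0[of p q] that by blast
    show "qfun p \<le> q" if "\<forall>x. 0 < x \<longrightarrow> x < pi/2 \<longrightarrow> 0 < gap p q x"
      using gap_pos_imp_ge_qfun[of p q] that by blast
  next
    \<comment> \<open>The strict sign is known at the threshold value of \<open>q\<close>;
      \<open>gap_mono\<close> carries it to every \<open>q\<close> on the right side of it.\<close>
    fix x assume x: "0 < x" "x < pi/2"
    show "0 < gap p q x" if "7/5 \<le> p" "p/3 + 8/15 \<le> q"
      using gap_pos_threshold_0[OF that(1) x] gap_mono[OF that(2) x, of p] by linarith
    show "gap p q x < 0" if "p0 \<le> p" "q \<le> qfun p"
      using gap_neg_threshold_pi_half[OF qfun_ge_1[OF that(1)] x] gap_mono[OF that(2) x, of p] by linarith
    show "gap p q x < 0" if "p \<le> 46/35" "q \<le> p/3 + 8/15"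
      using gap_neg_threshold_0[OF that(1) x] gap_mono[OF that(2) x, of p] by linarith
    show "0 < gap p q x" if "p \<le> p0star" "qfun p \<le> q"
      using gap_pos_threshold_pi_half[OF qfun_le[OF that(1)] x] gap_mono[OF that(2) x, of p] by linarith
  qed
qed

end
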